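(* Let $n$ be odd. Let $u,w\in\mathbb{F}_{2^n}$ with $u\neq0$, $w\neq0$, and put $z:=uw^{4}$, $\zeta:=1+1/w$, $\nu(x):=x^{3}+x$. Then: (a) $w\in V_u\iff\nu(z)=\nu(\zeta)\iff(z+\zeta)\bigl(z^{2}+\zeta z+\zeta^{2}+1\bigr)=0$. (b) (Type I: $z=\zeta$.) The condition $z=\zeta$ is equivalent to $uw^{5}=w+1$; and in this case $$w=\frac1{z+1},\qquad u=z(z+1)^4=z^{5}+z.$$ (c) (Type II: $z^2+\zeta z+\zeta^2+1=0$.) The condition $z^2+\zeta z+\zeta^2+1=0$ is equivalent to the following, with $\tau:=(u/z^{5})^{1/4}$: $$\tau^{2}+\tau=1+\frac1z,\qquad u=z^{5}\tau^{4},\qquad w=\frac1{z\tau}.$$ (d) For fixed $w\in\mathbb{F}_{2^n}\setminus\{0,1\}$, the number of $u\in\mathbb{F}_{2^n}^*$ with $w\in V_u$ is $3$ if $\operatorname{Tr}(1/(w+1))=0$ and $1$ otherwise; for $w=1$ the only $u\in\mathbb{F}_{2^n}^*$ with $w\in V_u$ is $u=1$. (e) (Counting.) $$\#\{u\ne0: v_u=3\}=\frac{2^{\,n-1}-1}{3},\qquad \#\{u\neq0: v_u=1\}=\frac{5\cdot2^{\,n-1}-2}{3}.$$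
   Context: $\mathbb{F}_{2^n}$ is the field with $2^n$ elements, with $n$ odd, and $\operatorname{Tr}(x)=\sum_{i=0}^{n-1}x^{2^i}$ is the absolute trace. $\sqrt{u}$ and $x^{1/4}$ denote the unique square root of $u$ and the unique fourth root of $x$ in $\mathbb{F}_{2^n}$. For $u\in\mathbb{F}_{2^n}^*$ let $Q_u(s)=\operatorname{Tr}(us^5+\sqrt u\,s^3)$ and let $$V_u=\{w\in\mathbb{F}_{2^n}: Q_u(s+w)+Q_u(s)+Q_u(w)=0\ \text{for all } s\in\mathbb{F}_{2^n}\}$$ be its radical (an $\mathbb{F}_2$-subspace), with $v_u=\dim_{\mathbb{F}_2}V_u$. *)

theory Defs
  imports "HOL-Number_Theory.Number_Theory" "HOL-Library.Cardinality"
begin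

text \<open>
  The field with \<open>2 ^ n\<close> elements is modelled by a type \<open>'a :: finite_field\<close> with
  \<open>CARD('a) = 2 ^ n\<close>. The definitions below take \<open>n\<close> as an explicit argument where needed.
\<close>

definition abs_trace :: "nat \<Rightarrow> 'a :: finite_field \<Rightarrow> 'a" where
  "abs_trace n x = (\<Sum>i<n. x ^ (2 ^ i))"

text \<open>
  Meaningful for \<open>k \<in> {2, 4}\<close> in characteristic 2, where the root exists and is unique
  (see \<open>the_root_eqI\<close> and \<open>the_root_power\<close>).
\<close>

definition the_root :: "nat \<Rightarrow> 'a :: finite_field \<Rightarrow> 'a" where
  "the_root k x = (THE r. r ^ k = x)"

definition Q :: "nat \<Rightarrow> 'a :: finite_field \<Rightarrow> 'a \<Rightarrow> 'a" where
  "Q n u s = abs_trace n (u * s ^ 5 + the_root 2 u * s ^ 3)"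

definition V :: "nat \<Rightarrow> 'a :: finite_field \<Rightarrow> 'a set" where
  "V n u = {w. \<forall>s. Q n u (s + w) + Q n u s + Q n u w = 0}"

text \<open>
  Scalar multiplication by \<^typ>\<open>gf2\<close>. It satisfies the vector space axioms exactly when the
  field has characteristic 2 (see \<open>vector_space_gf2_scale\<close>).
\<close>

definition gf2_scale :: "gf2 \<Rightarrow> 'a :: finite_field \<Rightarrow> 'a" where
  "gf2_scale c x = (if c = 0 then 0 else x)"

definition v :: "nat \<Rightarrow> 'a :: finite_field \<Rightarrow> nat" where
  "v n u = vector_space.dim gf2_scale (V n u)"

definition nu :: "'a :: finite_field \<Rightarrow> 'a" where
  "nu x = x ^ 3 + x"

lemma CHAR_eq_2:
  assumes "CARD('a :: finite_field) = 2 ^ n"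
  shows "CHAR('a) = 2"
proof -
  have "CHAR('a) dvd 2 ^ n"
    using CHAR_dvd_CARD[where ?'a = 'a] assms by simp
  moreover have "prime CHAR('a)"
    by simp
  ultimately show ?thesis
    by (metis prime_dvd_power primes_dvd_imp_eq two_is_prime_nat)
qed

lemma vector_space_gf2_scale:
  assumes "CHAR('a :: finite_field) = 2"
  shows "vector_space (gf2_scale :: gf2 \<Rightarrow> 'a \<Rightarrow> 'a)"
proof -
  have gf2: "c = 0 \<or> c = 1" for c :: gf2
    by transfer auto
  have "(1 :: gf2) + 1 = 0"
    by transfer auto
  then have [simp]: "(2 :: gf2) = 0"
    by simp
  have "of_nat 2 = (0 :: 'a)"
    using assms of_nat_CHAR by metis
  then have double: "x + x = 0" for x :: 'a
    by (metis mult_2 mult_zero_left of_nat_numeral)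
  show ?thesis
  proof
    fix a b :: gf2 and x y :: 'a
    show "gf2_scale a (x + y) = gf2_scale a x + gf2_scale a y"
      by (simp add: gf2_scale_def)
    show "gf2_scale (a + b) x = gf2_scale a x + gf2_scale b x"
      using gf2[of a] gf2[of b] by (auto simp: gf2_scale_def double)
    show "gf2_scale a (gf2_scale b x) = gf2_scale (a * b) x"
      by (simp add: gf2_scale_def)
    show "gf2_scale 1 x = x"
      by (simp add: gf2_scale_def)
  qed
qed

lemma inj_power_2_power:
  assumes "CHAR('a :: finite_field) = 2"
  shows "inj (\<lambda>x :: 'a. x ^ 2 ^ m)"
proof (rule injI)
  fix x y :: 'a
  assume eq: "x ^ 2 ^ m = y ^ 2 ^ m"
  have "(x - y + y) ^ 2 ^ m = (x - y) ^ 2 ^ m + y ^ 2 ^ m"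
    by (rule freshmans_dream') (use assms in auto)
  with eq show "x = y"
    by simp
qed

lemma the_root_eqI:
  assumes "CHAR('a :: finite_field) = 2" and "(r :: 'a) ^ 2 ^ m = x"
  shows "the_root (2 ^ m) x = r"
  unfolding the_root_def
  by (rule the_equality) (use assms inj_power_2_power[OF assms(1)] in \<open>auto dest: injD\<close>)

lemma the_root_power:
  assumes "CHAR('a :: finite_field) = 2"
  shows "the_root (2 ^ m) (x :: 'a) ^ 2 ^ m = x"
proof -
  have "surj (\<lambda>x :: 'a. x ^ 2 ^ m)"
    by (rule finite_UNIV_inj_surj[OF _ inj_power_2_power[OF assms]]) simp
  then obtain r where "x = r ^ 2 ^ m"
    by (rule surjE)
  with the_root_eqI[OF assms] show ?thesis
    by metis
qed

end

theory Submission
  imports Defs "HOL-Computational_Algebra.Polynomial"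
begin

text \<open>
  Moving all powers of \<open>s\<close> in the polar form of \<open>Q\<^sub>u\<close> to \<open>s\<^sup>4\<close> by Frobenius invariance of the trace shows
  that \<open>V\<^sub>u\<close> is the kernel of the linearized polynomial
  \<open>u w + u w\<^sup>2 + u\<^sup>2 w\<^sup>8 + u\<^sup>4 w\<^sup>1\<^sup>6 = z (\<nu>(z) + \<nu>(\<zeta>))\<close>, which gives the pointwise claims, and the
  fibre sizes follow by counting the solutions of \<open>y\<^sup>2 + y = c\<close>. For the global count, a Walsh sum
  \<open>S\<close> of \<open>Q\<^sub>u\<close> satisfies \<open>S\<^sup>2 = 0\<close> or \<open>S\<^sup>2 = 2 ^ (n + v\<^sub>u)\<close>, and not all of them vanish; hence \<open>v\<^sub>u\<close> is odd.
  As the linearized polynomial has degree 16, \<open>v\<^sub>u\<close> is 1 or 3, and counting the pairs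
  \<open>(u, w)\<close> with \<open>0 \<noteq> w \<in> V\<^sub>u\<close> in two ways determines both frequencies.
\<close>

text \<open>The additive character \<open>(-1) ^ Tr\<close>, with integer values so that squares of
  its sums can be compared with powers of 2.\<close>

definition trace_char :: "nat \<Rightarrow> 'a :: finite_field \<Rightarrow> int" where
  "trace_char n x = (if abs_trace n x = 0 then 1 else -1)"

definition q_arg :: "'a :: finite_field \<Rightarrow> 'a \<Rightarrow> 'a" where
  "q_arg u s = u * s ^ 5 + the_root 2 u * s ^ 3"

definition rad_poly :: "'a :: finite_field \<Rightarrow> 'a \<Rightarrow> 'a" where
  "rad_poly u w = u * w + u * w ^ 2 + u ^ 2 * w ^ 8 + u ^ 4 * w ^ 16"

context
  fixes n :: nat
  assumes odd_n: "odd n" and card_field: "CARD('a :: finite_field) = 2 ^ n"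
begin

section \<open>Arithmetic in characteristic 2\<close>

lemma char_2: "CHAR('a) = 2"
  using CHAR_eq_2[OF card_field] .

lemma two_eq_0: "(2 :: 'a) = 0"
  using of_nat_CHAR[where ?'a = 'a] by (simp add: char_2)

lemma add_self: "x + x = (0 :: 'a)"
  using two_eq_0 by (metis mult_2 mult_zero_left)

lemma add_self_left: "x + (x + y) = (y :: 'a)"
  by (simp add: add_self flip: add.assoc)

lemma add_eq_0: "x + y = 0 \<longleftrightarrow> x = (y :: 'a)"
  by (metis add_self add_right_cancel)

lemma minus_eq: "- x = (x :: 'a)"
  by (rule minus_unique) (rule add_self)

lemma diff_eq_add: "x - y = x + (y :: 'a)"
  by (simp only: diff_conv_add_uminus minus_eq)

lemma numeral_Bit0_eq_0: "numeral (num.Bit0 k) = (0 :: 'a)"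
  by (simp only: numeral_Bit0 add_self)

lemma numeral_Bit1_eq_1: "numeral (num.Bit1 k) = (1 :: 'a)"
  by (simp only: numeral_Bit1 add_self add_0)

lemmas char_2_simps =
  algebra_simps eval_nat_numeral add_self add_self_left minus_eq diff_eq_add
  numeral_Bit0_eq_0 numeral_Bit1_eq_1

lemma power_2_power_add: "(x + y :: 'a) ^ 2 ^ m = x ^ 2 ^ m + y ^ 2 ^ m"
  by (rule freshmans_dream') (simp_all add: char_2)

lemma power_sum_2: "(\<Sum>i\<in>A. f i :: 'a) ^ 2 = (\<Sum>i\<in>A. f i ^ 2)"
  by (rule freshmans_dream_sum) (simp_all add: char_2)

lemma power_field_card: "(x :: 'a) ^ 2 ^ n = x"
  using finite_field_power_card_eq_same[of x] by (simp add: card_field)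

section \<open>The absolute trace and Artin-Schreier equations\<close>

lemma trace_add: "abs_trace n (x + y :: 'a) = abs_trace n x + abs_trace n y"
  by (simp add: abs_trace_def power_2_power_add sum.distrib)

lemma trace_0: "abs_trace n (0 :: 'a) = 0"
  by (simp add: abs_trace_def power_0_left)

text \<open>All \<open>n\<close> summands are 1 and \<open>n\<close> is odd. Hence adding 1 to an
  argument flips its trace.\<close>

lemma trace_1: "abs_trace n (1 :: 'a) = 1"
proof -
  from odd_n obtain k where "n = 2 * k + 1"
    by (elim oddE)
  then show ?thesis
    by (simp add: abs_trace_def two_eq_0)
qed

lemma power_trace_2: "abs_trace n (x :: 'a) ^ 2 = abs_trace n (x ^ 2)"
  by (simp add: abs_trace_def power_sum_2 flip: power_mult) (simp add: mult.commute)

text \<open>Squaring advances every exponent by one step, and the overflow \<open>x ^ 2 ^ n\<close>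
  wraps around to \<open>x\<close>.\<close>

lemma trace_power_2: "abs_trace n ((x :: 'a) ^ 2) = abs_trace n x"
proof -
  have "abs_trace n (x ^ 2) = (\<Sum>i<n. x ^ 2 ^ Suc i)"
    by (simp add: abs_trace_def flip: power_mult)
  also have "x + \<dots> = (\<Sum>i<Suc n. x ^ 2 ^ i)"
    by (subst sum.lessThan_Suc_shift) simp
  also have "\<dots> = abs_trace n x + x"
    by (simp add: abs_trace_def power_field_card)
  finally show ?thesis
    by simp
qed

lemma trace_power_4: "abs_trace n ((x :: 'a) ^ 4) = abs_trace n x"
  using trace_power_2[of x] trace_power_2[of "x ^ 2"] by (simp flip: power_mult)

lemma trace_cases: "abs_trace n (x :: 'a) = 0 \<or> abs_trace n x = 1"
proof -
  have "abs_trace n x ^ 2 = abs_trace n x"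
    by (simp only: power_trace_2 trace_power_2)
  then show ?thesis
    by (simp add: power2_eq_square)
qed

lemma trace_nondegenerate:
  assumes "\<And>s. abs_trace n (s * c :: 'a) = 0"
  shows "c = 0"
proof (rule ccontr)
  assume "c \<noteq> 0"
  with assms[of "1 / c"] trace_1 show False
    by simp
qed

text \<open>For odd \<open>n\<close>, the half-trace \<open>c + c\<^sup>4 + c\<^sup>1\<^sup>6 + \<dots>\<close> solves \<open>y\<^sup>2 + y = c\<close>.\<close>

lemma artin_schreier_solvable:
  "(\<exists>y :: 'a. y ^ 2 + y = c) \<longleftrightarrow> abs_trace n c = 0"
proof
  assume "\<exists>y. y ^ 2 + y = c"
  then show "abs_trace n c = 0"
    by (auto simp: trace_add trace_power_2 add_self)
next
  assume tr: "abs_trace n c = 0"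
  from odd_n obtain k where n: "n = 2 * k + 1"
    by (elim oddE)
  define h where "h m = (\<Sum>i<m. c ^ 2 ^ (2 * i))" for m
  have pw: "(c ^ 2 ^ i) ^ 2 = c ^ 2 ^ Suc i" for i
    by (simp add: mult.commute flip: power_mult)
  have "h m ^ 2 + h m = (\<Sum>i<2 * m. c ^ 2 ^ i)" for m
  proof (induction m)
    case 0
    then show ?case by (simp add: h_def)
  next
    case (Suc m)
    have "h (Suc m) ^ 2 + h (Suc m) = (h m ^ 2 + h m) + c ^ 2 ^ (2 * m) + (c ^ 2 ^ (2 * m)) ^ 2"
      by (simp add: h_def char_2_simps)
    then show ?case
      unfolding Suc.IH pw by simp
  qed
  \<comment> \<open>The exponents now run over \<open>2 * k + 2 = n + 1\<close> values: the full
    trace and one surplus term \<open>c ^ 2 ^ n = c\<close>.\<close>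
  from this[of "Suc k"] have "h (Suc k) ^ 2 + h (Suc k) = abs_trace n c + c ^ 2 ^ n"
    by (simp add: abs_trace_def n)
  then show "\<exists>y. y ^ 2 + y = c"
    by (auto simp: tr power_field_card)
qed

section \<open>Character sums\<close>

lemma trace_char_add: "trace_char n (x + y :: 'a) = trace_char n x * trace_char n y"
  using trace_cases[of x] trace_cases[of y] by (auto simp: trace_char_def trace_add two_eq_0)

text \<open>Translating by an element with character value \<open>-1\<close> negates the sum.\<close>

lemma sum_trace_char_subgroup:
  assumes add: "\<And>x y :: 'a. x \<in> S \<Longrightarrow> y \<in> S \<Longrightarrow> x + y \<in> S"
    and hom: "\<And>x y. x \<in> S \<Longrightarrow> y \<in> S \<Longrightarrow> trace_char n (f (x + y) :: 'a) = trace_char n (f x) * trace_char n (f y)"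
  shows "(\<Sum>x\<in>S. trace_char n (f x)) =
    (if \<forall>x\<in>S. trace_char n (f x) = 1 then int (card S) else 0)"
proof (cases "\<forall>x\<in>S. trace_char n (f x) = 1")
  case False
  then obtain a where a: "a \<in> S" "trace_char n (f a) = - 1"
    by (auto simp: trace_char_def split: if_splits)
  have "(\<Sum>x\<in>S. trace_char n (f x)) = (\<Sum>x\<in>S. trace_char n (f (a + x)))"
    by (rule sum.reindex_bij_witness[of _ "\<lambda>x. a + x" "\<lambda>x. a + x"])
      (use a add in \<open>auto simp: add_self simp flip: add.assoc\<close>)
  also have "\<dots> = - (\<Sum>x\<in>S. trace_char n (f x))"
    using a by (simp add: hom flip: sum_negf)
  finally show ?thesis
    using False by auto
qed simp

text \<open>Orthogonality: for \<open>c \<noteq> 0\<close>, nondegeneracy of the trace makes the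
  character nontrivial.\<close>

lemma sum_trace_char_mult:
  "(\<Sum>s\<in>UNIV. trace_char n (s * c :: 'a)) = (if c = 0 then 2 ^ n else 0)"
proof -
  have "(\<forall>s. trace_char n (s * c) = 1) \<longleftrightarrow> c = 0"
    using trace_nondegenerate[of c] by (auto simp: trace_char_def trace_0 split: if_splits)
  then show ?thesis
    by (subst sum_trace_char_subgroup) (auto simp: distrib_right trace_char_add card_field)
qed

section \<open>The radical as the kernel of a linearized polynomial\<close>

lemma bij_power_4: "bij (\<lambda>x :: 'a. x ^ 4)"
  using inj_power_2_power[OF char_2, of 2] by (simp add: finite_UNIV_inj_surj bij_def)

lemma sqrt_power_2: "the_root 2 (x :: 'a) ^ 2 = x"
  using the_root_power[OF char_2, of 1 x] by simp

lemma root_4_power_4: "the_root 4 (x :: 'a) ^ 4 = x"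
  using the_root_power[OF char_2, of 2 x] by simp

text \<open>Each term of the polar form is raised to the power 1, 2 or 4 that turns its factor in
  \<open>s\<close> into \<open>s ^ 4\<close>. Aiming at \<open>s ^ 4\<close> rather than
  \<open>s\<close> keeps the coefficients polynomial in \<open>u\<close> and
  \<open>w\<close>.\<close>

lemma trace_polar:
  "abs_trace n (q_arg u (s + w) + q_arg u s + q_arg u w :: 'a) = abs_trace n (s ^ 4 * rad_poly u w)"
proof -
  define e where "e = the_root 2 u"
  have e: "u = e ^ 2"
    by (simp add: e_def sqrt_power_2)
  have "q_arg u (s + w) + q_arg u s + q_arg u w =
      u * s ^ 4 * w + u * s * w ^ 4 + e * s ^ 2 * w + e * s * w ^ 2"
    unfolding q_arg_def e_def[symmetric] by (simp add: char_2_simps)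
  moreover have "s ^ 4 * rad_poly u w =
      u * s ^ 4 * w + (u * s * w ^ 4) ^ 4 + (e * s ^ 2 * w) ^ 2 + (e * s * w ^ 2) ^ 4"
    by (simp add: rad_poly_def e power_mult_distrib algebra_simps flip: power_mult)
  ultimately show ?thesis
    by (simp add: trace_add trace_power_2 trace_power_4)
qed

text \<open>Fourth powers exhaust the field, so nondegeneracy of the trace applies to
  \<open>s ^ 4\<close> as well as to \<open>s\<close>.\<close>

lemma mem_V_iff: "(w :: 'a) \<in> V n u \<longleftrightarrow> rad_poly u w = 0"
proof -
  have Q: "Q n u (s + w) + Q n u s + Q n u w = abs_trace n (s ^ 4 * rad_poly u w)" for s
    unfolding trace_polar[symmetric] by (simp add: Q_def q_arg_def trace_add)
  have "rad_poly u w = 0" if "\<And>s. abs_trace n (s ^ 4 * rad_poly u w) = 0"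
  proof (rule trace_nondegenerate)
    fix s
    show "abs_trace n (s * rad_poly u w) = 0"
      using that[of "the_root 4 s"] by (simp add: root_4_power_4)
  qed
  then show ?thesis
    by (auto simp: V_def Q trace_0)
qed

lemma rad_poly_add: "rad_poly u (x + y :: 'a) = rad_poly u x + rad_poly u y"
proof -
  have "(x + y) ^ 2 = x ^ 2 + y ^ 2"
    by (simp add: char_2_simps)
  with power_2_power_add[of x y 3] power_2_power_add[of x y 4] show ?thesis
    by (simp add: rad_poly_def distrib_left add_ac)
qed

lemma V_add: "x \<in> V n u \<Longrightarrow> y \<in> V n u \<Longrightarrow> (x + y :: 'a) \<in> V n u"
  by (simp add: mem_V_iff rad_poly_add)

lemma zero_mem_V: "(0 :: 'a) \<in> V n u"
  by (simp add: mem_V_iff rad_poly_def)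

lemma card_V_le:
  assumes "u \<noteq> (0 :: 'a)"
  shows "card (V n u) \<le> 16"
proof -
  let ?p = "monom u 1 + monom u 2 + monom (u ^ 2) 8 + monom (u ^ 4) 16"
  have "coeff ?p 16 \<noteq> 0"
    using assms by simp
  then have "?p \<noteq> 0"
    by (metis coeff_0)
  moreover have "V n u = {w. poly ?p w = 0}"
    by (auto simp: mem_V_iff rad_poly_def poly_monom)
  moreover have "degree ?p \<le> 16"
    by (intro degree_add_le order_trans[OF degree_monom_le]) auto
  ultimately show ?thesis
    using card_poly_roots_bound[of ?p] by simp
qed

section \<open>Walsh sums and the size of the radical\<close>

definition walsh_sum :: "'a \<Rightarrow> 'a \<Rightarrow> int" where
  "walsh_sum u a = (\<Sum>s\<in>UNIV. trace_char n (q_arg u s + s * a))"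

text \<open>Expand the square and substitute \<open>t = s + w\<close>. The polar form isolates a sum
  over \<open>s\<close> that by orthogonality survives only for \<open>w\<close> in the
  radical.\<close>

lemma walsh_sum_power_2:
  "walsh_sum u a ^ 2 = 2 ^ n * (\<Sum>w\<in>V n u. trace_char n (q_arg u w + w * a))"
proof -
  define f where "f s = q_arg u s + s * a" for s
  have polar: "trace_char n (f s) * trace_char n (f (s + w)) =
      trace_char n (f w) * trace_char n (s ^ 4 * rad_poly u w)" for s w
  proof -
    have "f s + f (s + w) = f w + (q_arg u (s + w) + q_arg u s + q_arg u w)"
      by (simp add: f_def char_2_simps)
    then show ?thesis
      by (metis trace_char_add trace_char_def trace_polar)
  qed
  have "walsh_sum u a ^ 2 = (\<Sum>s\<in>UNIV. \<Sum>t\<in>UNIV. trace_char n (f s) * trace_char n (f t))"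
    by (simp add: walsh_sum_def f_def power2_eq_square sum_product)
  also have "\<dots> = (\<Sum>s\<in>UNIV. \<Sum>w\<in>UNIV. trace_char n (f s) * trace_char n (f (s + w)))"
  proof (rule sum.cong[OF refl])
    fix s
    show "(\<Sum>t\<in>UNIV. trace_char n (f s) * trace_char n (f t)) =
        (\<Sum>w\<in>UNIV. trace_char n (f s) * trace_char n (f (s + w)))"
      by (rule sum.reindex_bij_witness[of _ "\<lambda>w. s + w" "\<lambda>t. s + t"]) (simp_all add: add_self_left)
  qed
  also have "\<dots> = (\<Sum>w\<in>UNIV. trace_char n (f w) * (\<Sum>s\<in>UNIV. trace_char n (s ^ 4 * rad_poly u w)))"
    by (subst sum.swap) (simp add: polar sum_distrib_left)
  \<comment> \<open>Replacing \<open>s ^ 4\<close> by \<open>s\<close> permutes the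
    summands.\<close>
  also have "\<dots> = (\<Sum>w\<in>UNIV. trace_char n (f w) * (if w \<in> V n u then 2 ^ n else 0))"
    using sum.reindex_bij_betw[OF bij_power_4, of "\<lambda>s. trace_char n (s * rad_poly u w)" for w]
    by (simp add: sum_trace_char_mult mem_V_iff)
  also have "\<dots> = (\<Sum>w\<in>V n u. trace_char n (f w) * 2 ^ n)"
    by (rule sum.mono_neutral_cong_right) auto
  finally show ?thesis
    by (simp add: f_def sum_distrib_left mult.commute)
qed

text \<open>Fourier inversion at 0: summing over the linear twist \<open>a\<close> leaves only
  \<open>s = 0\<close>.\<close>

lemma sum_walsh_sum: "(\<Sum>a\<in>UNIV. walsh_sum u a) = 2 ^ n"
proof -
  have "(\<Sum>a\<in>UNIV. walsh_sum u a) = (\<Sum>s\<in>UNIV. trace_char n (q_arg u s) * (\<Sum>a\<in>UNIV. trace_char n (a * s)))"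
    unfolding walsh_sum_def by (subst sum.swap) (simp add: trace_char_add sum_distrib_left mult.commute)
  also have "\<dots> = (\<Sum>s\<in>(UNIV :: 'a set). if s = 0 then 2 ^ n else 0)"
    using trace_0 by (intro sum.cong) (auto simp: sum_trace_char_mult q_arg_def, simp add: trace_char_def)
  finally show ?thesis
    by simp
qed

text \<open>The witness is the absolute value of a nonzero Walsh coefficient, which exists because these
  coefficients add up to \<open>2 ^ n\<close>.\<close>

lemma card_V_square: "\<exists>x :: nat. x ^ 2 = 2 ^ n * card (V n u :: 'a set)"
proof -
  obtain a where a: "walsh_sum u a \<noteq> 0"
    using sum_walsh_sum[of u] sum.neutral[of UNIV "walsh_sum u"] by fastforce
  \<comment> \<open>On the radical the polar form has trace 0, so the twisted quadratic form gives a
    genuine character there.\<close>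
  have hom: "trace_char n (q_arg u (x + y) + (x + y) * a) =
      trace_char n (q_arg u x + x * a) * trace_char n (q_arg u y + y * a)"
    if "x \<in> V n u" "y \<in> V n u" for x y
  proof -
    have "q_arg u (x + y) + (x + y) * a =
        (q_arg u x + x * a) + (q_arg u y + y * a) + (q_arg u (x + y) + q_arg u x + q_arg u y)"
      by (simp add: char_2_simps)
    moreover have "trace_char n (q_arg u (x + y) + q_arg u x + q_arg u y) = 1"
      using that trace_polar[of u x y] by (simp add: trace_char_def mem_V_iff trace_0)
    ultimately show ?thesis
      by (metis mult.right_neutral trace_char_add)
  qed
  have "walsh_sum u a ^ 2 = 2 ^ n * int (card (V n u))"
    using a walsh_sum_power_2[of u a]
      sum_trace_char_subgroup[where S = "V n u" and f = "\<lambda>w. q_arg u w + w * a"] V_add hom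
    by (auto split: if_splits)
  then have "int (nat \<bar>walsh_sum u a\<bar> ^ 2) = int (2 ^ n * card (V n u))"
    by simp
  then show ?thesis
    unfolding of_nat_eq_iff by blast
qed

section \<open>The dimension of the radical\<close>

text \<open>With only the scalars 0 and 1, a new basis vector \<open>b\<close> adds one disjoint
  translate of the old span and so doubles its size.\<close>

lemma card_span_independent:
  assumes "module.independent gf2_scale (B :: 'a set)"
  shows "card (module.span gf2_scale B) = 2 ^ card B"
proof -
  interpret vector_space "gf2_scale :: gf2 \<Rightarrow> 'a \<Rightarrow> 'a"
    by (rule vector_space_gf2_scale[OF char_2])
  have gf2: "c = 0 \<or> c = 1" for c :: gf2
    by transfer auto
  have "finite B"
    by simp
  then show ?thesis
    using assms
  proof (induction B)
    case empty
    then show ?case by simp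
  next
    case (insert b B)
    then have b: "b \<notin> span B" "independent B"
      by (auto simp: independent_insert)
    have "span (insert b B) = span B \<union> (+) b ` span B"
    proof (intro subset_antisym subsetI)
      fix x
      assume "x \<in> span (insert b B)"
      then obtain k where "x - gf2_scale k b \<in> span B"
        unfolding span_insert by auto
      with gf2[of k] show "x \<in> span B \<union> (+) b ` span B"
        by (auto simp: gf2_scale_def image_iff intro: bexI[of _ "x - b"])
    next
      fix x
      assume "x \<in> span B \<union> (+) b ` span B"
      then show "x \<in> span (insert b B)"
        using span_mono[of B "insert b B"] by (auto intro: span_add span_base)
    qed
    moreover have "span B \<inter> (+) b ` span B = {}"
      using b(1) span_diff by fastforce
    ultimately show ?case
      using insert b(2) by (simp add: card_Un_disjoint card_image)
  qed
qed

lemma card_V: "card (V n u :: 'a set) = 2 ^ v n u"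
proof -
  interpret vector_space "gf2_scale :: gf2 \<Rightarrow> 'a \<Rightarrow> 'a"
    by (rule vector_space_gf2_scale[OF char_2])
  obtain B where B: "B \<subseteq> V n u" "independent B" "V n u \<subseteq> span B" "card B = dim (V n u)"
    by (rule basis_exists)
  have "subspace (V n u)"
    by (rule subspaceI) (simp_all add: zero_mem_V V_add gf2_scale_def)
  with B have "span B = V n u"
    by (simp add: span_subspace)
  with B card_span_independent[OF B(2)] show ?thesis
    by (simp add: v_def)
qed

lemma v_cases:
  assumes "u \<noteq> (0 :: 'a)"
  shows "v n u = 1 \<or> v n u = 3"
proof -
  obtain x :: nat where x: "x ^ 2 = 2 ^ (n + v n u)"
    using card_V_square[of u] by (auto simp: card_V power_add)
  \<comment> \<open>A power of 2 that is a square has an even exponent, so \<open>v n u\<close> has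
    the parity of \<open>n\<close>.\<close>
  then have "x dvd 2 ^ (n + v n u)"
    by (metis dvd_power zero_less_numeral)
  then obtain k where "x = 2 ^ k"
    by (auto simp: divides_primepow_nat)
  with x have "2 * k = n + v n u"
    by (simp flip: power_mult)
  then have "odd (v n u)"
    using odd_n by presburger
  moreover have "(2 :: nat) ^ v n u \<le> 2 ^ 4"
    using card_V_le[OF assms] by (simp add: card_V)
  then have "v n u \<le> 4"
    by (simp only: power_increasing_iff)
  ultimately show ?thesis
    by presburger
qed

section \<open>The factorization of membership and its two types\<close>

lemma nu_add: "nu x + nu y = (x + y) * (x ^ 2 + y * x + y ^ 2 + 1 :: 'a)"
  by (simp add: nu_def char_2_simps)

lemma nu_eq_iff: "nu x = nu (y :: 'a) \<longleftrightarrow> (x + y) * (x ^ 2 + y * x + y ^ 2 + 1) = 0"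
  by (simp only: add_eq_0 flip: nu_add)

text \<open>With \<open>t = 1 / w\<close> the four terms of \<open>rad_poly u w\<close> are
  \<open>z * t ^ 3\<close>, \<open>z * t ^ 2\<close>, \<open>z ^ 2\<close> and \<open>z ^ 4\<close>,
  and the nonzero factor \<open>z\<close> cancels.\<close>

lemma mem_V_iff_nu:
  assumes "u \<noteq> 0" "w \<noteq> (0 :: 'a)"
  shows "w \<in> V n u \<longleftrightarrow> nu (u * w ^ 4) = nu (1 + 1 / w)"
proof -
  define t where "t = 1 / w"
  define z where "z = u * w ^ 4"
  have "nu z + nu (1 + t) = z ^ 3 + z + t ^ 2 + t ^ 3"
    by (simp add: nu_def char_2_simps)
  moreover have "rad_poly u w = z * (z ^ 3 + z + t ^ 2 + t ^ 3)"
    using assms by (simp add: rad_poly_def z_def t_def field_simps eval_nat_numeral)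
  moreover have "z \<noteq> 0"
    using assms by (simp add: z_def)
  ultimately have "rad_poly u w = 0 \<longleftrightarrow> nu z + nu (1 + t) = 0"
    by simp
  then show ?thesis
    by (simp add: mem_V_iff add_eq_0 z_def t_def)
qed

lemma type_I_iff:
  assumes "w \<noteq> (0 :: 'a)"
  shows "u * w ^ 4 = 1 + 1 / w \<longleftrightarrow> u * w ^ 5 = w + 1"
  using assms by (simp add: field_simps eval_nat_numeral)

lemma type_I_param:
  assumes "w \<noteq> (0 :: 'a)" and z: "u * w ^ 4 = 1 + 1 / w"
  shows "w = 1 / (u * w ^ 4 + 1)" "u = u * w ^ 4 * (u * w ^ 4 + 1) ^ 4"
proof -
  have z1: "u * w ^ 4 + 1 = 1 / w"
    unfolding z by (simp add: char_2_simps)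
  show "w = 1 / (u * w ^ 4 + 1)" "u = u * w ^ 4 * (u * w ^ 4 + 1) ^ 4"
    unfolding z1 using assms(1) by (simp_all add: power_divide)
qed

lemma type_I_poly: "z * (z + 1) ^ 4 = z ^ 5 + (z :: 'a)"
  by (simp add: char_2_simps)

text \<open>The two parametrizing equations come from the definitions of \<open>z\<close> and
  \<tau>. Inserting \<open>1 / w = z * \<tau>\<close> into the quadratic and dividing by
  \<open>z ^ 2\<close> leaves the condition on \<tau>.\<close>

lemma type_II_iff:
  fixes u w :: 'a
  assumes "u \<noteq> 0" "w \<noteq> 0"
  defines "z \<equiv> u * w ^ 4"
  defines "\<tau> \<equiv> the_root 4 (u / z ^ 5)"
  shows "u = z ^ 5 * \<tau> ^ 4" "w = 1 / (z * \<tau>)"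
    "z ^ 2 + (1 + 1 / w) * z + (1 + 1 / w) ^ 2 + 1 = 0 \<longleftrightarrow> \<tau> ^ 2 + \<tau> = 1 + 1 / z"
proof -
  have z: "z \<noteq> 0"
    using assms by simp
  show u: "u = z ^ 5 * \<tau> ^ 4"
    using z by (simp add: \<tau>_def root_4_power_4)
  then have "\<tau> \<noteq> 0"
    using assms(1) by (auto simp: power_0_left)
  \<comment> \<open>Combining \<open>z = u * w ^ 4\<close> with the formula for \<open>u\<close>
    shows that \<open>w * (z * \<tau>)\<close> has fourth power 1; injectivity then gives 1.\<close>
  have "z * (w * (z * \<tau>)) ^ 4 = (z ^ 5 * \<tau> ^ 4) * w ^ 4"
    by (simp add: power_mult_distrib eval_nat_numeral)
  also have "\<dots> = z"
    unfolding u[symmetric] by (simp add: z_def)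
  finally have "(w * (z * \<tau>)) ^ 4 = 1 ^ 4"
    using z by simp
  then have "w * (z * \<tau>) = 1"
    by (rule injD[OF bij_is_inj[OF bij_power_4]])
  with z \<open>\<tau> \<noteq> 0\<close> show w: "w = 1 / (z * \<tau>)"
    by (simp add: field_simps)
  have "z ^ 2 + (1 + 1 / w) * z + (1 + 1 / w) ^ 2 + 1 = z ^ 2 * ((\<tau> ^ 2 + \<tau>) + (1 + 1 / z))"
    unfolding w using z by (simp add: char_2_simps)
  with z show "z ^ 2 + (1 + 1 / w) * z + (1 + 1 / w) ^ 2 + 1 = 0 \<longleftrightarrow> \<tau> ^ 2 + \<tau> = 1 + 1 / z"
    by (simp add: add_eq_0)
qed

section \<open>Fibre sizes for fixed \<open>w\<close>\<close>

lemma card_artin_schreier: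
  "card {y :: 'a. y ^ 2 + y = c} = (if abs_trace n c = 0 then 2 else 0)"
proof (cases "abs_trace n c = 0")
  case True
  then obtain y where y: "y ^ 2 + y = c"
    using artin_schreier_solvable by blast
  have "x ^ 2 + x = c \<longleftrightarrow> x = y \<or> x = y + 1" for x
  proof -
    have "x ^ 2 + x + c = (x + y) * (x + (y + 1))"
      by (simp add: char_2_simps flip: y)
    then show ?thesis
      by (metis add_eq_0 mult_eq_0_iff)
  qed
  then have "{x. x ^ 2 + x = c} = {y, y + 1}"
    by auto
  with True show ?thesis
    by simp
next
  case False
  with artin_schreier_solvable show ?thesis
    by auto
qed

lemma trace_power_m2: "abs_trace n (1 / (x :: 'a) ^ 2) = abs_trace n (1 / x)"
  using trace_power_2[of "1 / x"] by (simp add: power_divide)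

text \<open>Scaling by \<zeta> turns the quadratic factor into
  \<open>y ^ 2 + y = 1 + 1 / \<zeta> ^ 2\<close>, with 2 or 0 solutions. The root \<zeta> of the
  linear factor is a further one, since there the quadratic takes the value
  \<open>(\<zeta> + 1) ^ 2 \<noteq> 0\<close>.\<close>

lemma card_nu_eq:
  assumes "\<zeta> \<noteq> 0" "\<zeta> \<noteq> (1 :: 'a)"
  shows "card {z. nu z = nu \<zeta>} = (if abs_trace n (1 / \<zeta>) = 1 then 3 else 1)"
proof -
  let ?R = "{z. z ^ 2 + \<zeta> * z + \<zeta> ^ 2 + 1 = 0}"
  let ?c = "1 + 1 / \<zeta> ^ 2"
  have "z ^ 2 + \<zeta> * z + \<zeta> ^ 2 + 1 = 0 \<longleftrightarrow> (z / \<zeta>) ^ 2 + z / \<zeta> = ?c" for z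
  proof -
    have "z ^ 2 + \<zeta> * z + \<zeta> ^ 2 + 1 = \<zeta> ^ 2 * (((z / \<zeta>) ^ 2 + z / \<zeta>) + ?c)"
      using assms(1) by (simp add: field_simps power2_eq_square)
    then show ?thesis
      using assms(1) by (simp only: mult_eq_0_iff power_eq_0_iff add_eq_0) simp
  qed
  then have R: "?R = {z. (z / \<zeta>) ^ 2 + z / \<zeta> = ?c}"
    by (simp only:)
  have "bij_betw (\<lambda>z. z / \<zeta>) ?R {y. y ^ 2 + y = ?c}"
    unfolding R using assms(1) by (intro bij_betw_byWitness[where f' = "\<lambda>y. y * \<zeta>"]) auto
  then have "card ?R = (if abs_trace n ?c = 0 then 2 else 0)"
    by (simp only: bij_betw_same_card card_artin_schreier)
  moreover have "abs_trace n ?c = 0 \<longleftrightarrow> abs_trace n (1 / \<zeta>) = 1"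
    unfolding trace_add trace_1 trace_power_m2 add_eq_0 by auto
  moreover have "\<zeta> \<notin> ?R"
  proof
    assume "\<zeta> \<in> ?R"
    then have "\<zeta> ^ 2 + 1 = 0"
      by (simp add: power2_eq_square add_self)
    moreover have "\<zeta> ^ 2 + 1 = (\<zeta> + 1) ^ 2"
      by (simp add: char_2_simps)
    ultimately show False
      using assms(2) by (simp add: add_eq_0)
  qed
  moreover have "{z. nu z = nu \<zeta>} = insert \<zeta> ?R"
    by (auto simp: nu_eq_iff add_eq_0)
  ultimately show ?thesis
    by simp
qed

lemma card_fibre:
  assumes "w \<noteq> 0" "w \<noteq> (1 :: 'a)"
  shows "card {u. u \<noteq> 0 \<and> w \<in> V n u} = (if abs_trace n (1 / (w + 1)) = 0 then 3 else 1)"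
proof -
  let ?\<zeta> = "1 + 1 / w"
  have w1: "w + 1 \<noteq> 0"
    using assms by (simp add: add_eq_0)
  have \<zeta>: "?\<zeta> = (w + 1) / w"
    using assms by (simp add: field_simps)
  \<comment> \<open>A nonzero value here keeps \<open>z = 0\<close> out of the fibre, matching
    \<open>u \<noteq> 0\<close>.\<close>
  have "nu ?\<zeta> = ?\<zeta> * (1 / w) ^ 2"
    by (simp add: nu_def char_2_simps)
  then have "nu ?\<zeta> \<noteq> 0"
    using assms w1 by (simp add: \<zeta>)
  then have "z \<noteq> 0" if "nu z = nu ?\<zeta>" for z
    using that by (auto simp: nu_def)
  then have "bij_betw (\<lambda>u. u * w ^ 4) {u. u \<noteq> 0 \<and> w \<in> V n u} {z. nu z = nu ?\<zeta>}"
    using assms by (intro bij_betw_byWitness[where f' = "\<lambda>z. z / w ^ 4"]) (auto simp: mem_V_iff_nu)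
  then have "card {u. u \<noteq> 0 \<and> w \<in> V n u} = card {z. nu z = nu ?\<zeta>}"
    by (rule bij_betw_same_card)
  also have "\<dots> = (if abs_trace n (1 / ?\<zeta>) = 1 then 3 else 1)"
    using assms w1 by (intro card_nu_eq) (simp_all add: \<zeta>)
  \<comment> \<open>The summand 1 has trace 1, which turns the condition trace 1 into trace
    0.\<close>
  also have "1 / ?\<zeta> = 1 + 1 / (w + 1)"
    using assms w1 by (simp add: \<zeta> field_simps add_self_left)
  finally show ?thesis
    by (simp add: trace_add trace_1)
qed

text \<open>Here \<zeta> is 0 and \<open>z = u\<close>: the type I root 0 is excluded and both type
  II roots coincide at 1.\<close>

lemma fibre_1: "{u :: 'a. u \<noteq> 0 \<and> 1 \<in> V n u} = {1}"
proof -
  have "1 \<in> V n u \<longleftrightarrow> u = 1" if "u \<noteq> 0" for u :: 'a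
  proof -
    have "nu (1 + 1 / 1 :: 'a) = 0"
      by (simp add: nu_def two_eq_0)
    with mem_V_iff_nu[OF that, of 1] have "1 \<in> V n u \<longleftrightarrow> nu u = 0"
      by simp
    moreover have "nu u = u * (u + 1) ^ 2"
      by (simp add: nu_def char_2_simps)
    ultimately show ?thesis
      using that by (simp add: add_eq_0)
  qed
  then show ?thesis
    by auto
qed

section \<open>Double counting and the frequencies of \<open>v n u\<close>\<close>

lemma n_pos: "n > 0"
  using odd_n by (rule odd_pos)

text \<open>The character sum over the field is 0, so both trace values are equally
  frequent.\<close>

lemma card_trace_0: "card {y :: 'a. abs_trace n y = 0} = 2 ^ (n - 1)"
proof -
  let ?K = "{y :: 'a. abs_trace n y = 0}"
  have "(\<Sum>s\<in>(UNIV :: 'a set). trace_char n s) = (\<Sum>s\<in>?K. 1) + (\<Sum>s\<in>- ?K. - 1)"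
    by (simp add: trace_char_def sum.If_cases)
  then have "card ?K = card (- ?K)"
    using sum_trace_char_mult[of 1] by simp
  moreover have "card ?K + card (- ?K) = 2 ^ n"
    by (metis card_field card_Un_disjoint Compl_disjoint Compl_partition finite)
  ultimately have "2 * card ?K = 2 * 2 ^ (n - 1)"
    using n_pos by (simp flip: power_Suc)
  then show ?thesis
    by simp
qed

text \<open>Under \<open>y = 1 / (w + 1)\<close>, the excluded \<open>w = 1\<close> accounts for
  removing \<open>y = 0\<close>, while \<open>w = 0\<close> would give \<open>y = 1\<close>, whose
  trace is 1.\<close>

lemma card_trace_inverse_0:
  "card {w :: 'a. w \<noteq> 0 \<and> w \<noteq> 1 \<and> abs_trace n (1 / (w + 1)) = 0} = 2 ^ (n - 1) - 1"
proof -
  have "bij_betw (\<lambda>w. 1 / (w + 1)) {w :: 'a. w \<noteq> 0 \<and> w \<noteq> 1 \<and> abs_trace n (1 / (w + 1)) = 0}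
      ({y. abs_trace n y = 0} - {0})"
  proof (rule bij_betw_byWitness[where f' = "\<lambda>y. 1 / y + 1"])
    show "(\<lambda>y. 1 / y + 1) ` ({y :: 'a. abs_trace n y = 0} - {0}) \<subseteq>
        {w. w \<noteq> 0 \<and> w \<noteq> 1 \<and> abs_trace n (1 / (w + 1)) = 0}"
      using trace_1 by (auto simp: add_eq_0 add_self add.assoc)
  qed (auto simp: add_eq_0 add_self add.assoc)
  then have "card {w :: 'a. w \<noteq> 0 \<and> w \<noteq> 1 \<and> abs_trace n (1 / (w + 1)) = 0} =
      card ({y :: 'a. abs_trace n y = 0} - {0})"
    by (rule bij_betw_same_card)
  then show ?thesis
    by (simp add: card_trace_0 trace_0)
qed

lemma card_nonzero: "card {x :: 'a. x \<noteq> 0} = 2 ^ n - 1"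
  using card_Diff_singleton[of "0 :: 'a" UNIV] by (simp add: card_field set_diff_eq)

lemma sum_card_V:
  "(\<Sum>u | u \<noteq> (0 :: 'a). card {w. w \<noteq> 0 \<and> w \<in> V n u}) = 2 ^ (n + 1) - 3"
proof -
  let ?S = "{w :: 'a. w \<noteq> 0 \<and> w \<noteq> 1}"
  have S1: "{w :: 'a. w \<noteq> 0} = insert 1 ?S"
    by auto
  have "card (insert 1 ?S) = Suc (card ?S)"
    by simp
  then have S2: "card ?S = 2 ^ n - 2"
    using card_nonzero unfolding S1 by simp
  have "(\<Sum>u | u \<noteq> (0 :: 'a). card {w. w \<noteq> 0 \<and> w \<in> V n u}) =
      (\<Sum>w | w \<noteq> (0 :: 'a). card {u. u \<noteq> 0 \<and> w \<in> V n u})"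
    using sum_multicount_gen[of "{u. u \<noteq> 0}" "{w. w \<noteq> 0}" "\<lambda>u w. w \<in> V n u"
      "\<lambda>w. card {u. u \<noteq> 0 \<and> w \<in> V n u}"] by simp
  also have "\<dots> = 1 + (\<Sum>w\<in>?S. card {u. u \<noteq> 0 \<and> w \<in> V n u})"
    unfolding S1 by (simp add: fibre_1)
  \<comment> \<open>Writing 3 or 1 as 1 plus 2 or 0 reduces the sum to counting trace-zero
    elements.\<close>
  also have "(\<Sum>w\<in>?S. card {u. u \<noteq> 0 \<and> w \<in> V n u}) =
      (\<Sum>w\<in>?S. 1 + (if abs_trace n (1 / (w + 1)) = 0 then 2 else 0))"
    by (intro sum.cong) (auto simp: card_fibre)
  also have "\<dots> = (2 ^ n - 2) + 2 * (2 ^ (n - 1) - 1)"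
    unfolding sum.distrib
    by (subst sum.inter_filter[symmetric]) (simp_all add: S2 card_trace_inverse_0 conj_assoc)
  also have "2 * (2 ^ (n - 1) - 1) = (2 ^ n - 2 :: nat)"
    using n_pos by (simp add: diff_mult_distrib2 flip: power_Suc)
  \<comment> \<open>The truncated subtractions are exact because \<open>n > 0\<close> gives
    \<open>2 \<le> 2 ^ n\<close>.\<close>
  also have "1 + (2 ^ n - 2 + (2 ^ n - 2)) = (2 ^ (n + 1) - 3 :: nat)"
    using n_pos self_le_power[of "2 :: nat" n] by simp
  finally show ?thesis .
qed

lemma card_v_eq:
  shows "real (card {u :: 'a. u \<noteq> 0 \<and> v n u = 3}) = (2 ^ (n - 1) - 1) / 3"
    and "real (card {u :: 'a. u \<noteq> 0 \<and> v n u = 1}) = (5 * 2 ^ (n - 1) - 2) / 3"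
proof -
  let ?A = "{u :: 'a. u \<noteq> 0 \<and> v n u = 1}" and ?B = "{u :: 'a. u \<noteq> 0 \<and> v n u = 3}"
  have U: "{u :: 'a. u \<noteq> 0} = ?A \<union> ?B" "?A \<inter> ?B = {}"
    using v_cases by auto
  have total: "card ?A + card ?B = 2 ^ n - 1"
    using card_nonzero U by (simp add: card_Un_disjoint)
  have "card {w. w \<noteq> 0 \<and> w \<in> V n u} = 2 ^ v n u - 1" for u :: 'a
  proof -
    have "{w. w \<noteq> 0 \<and> w \<in> V n u} = V n u - {0}"
      by auto
    then show ?thesis
      by (simp add: zero_mem_V card_V)
  qed
  then have "(\<Sum>u\<in>?A \<union> ?B. 2 ^ v n u - 1) = (2 ^ (n + 1) - 3 :: nat)"
    using sum_card_V unfolding U(1) by simp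
  also have "(\<Sum>u\<in>?A \<union> ?B. 2 ^ v n u - 1) = (\<Sum>u\<in>?A. 2 ^ v n u - 1) + (\<Sum>u\<in>?B. 2 ^ v n u - 1)"
    by (rule sum.union_disjoint) (use U(2) in auto)
  \<comment> \<open>The weights are \<open>2 ^ 1 - 1\<close> and \<open>2 ^ 3 - 1\<close>; with
    \<open>total\<close> this is a linear system for the two cardinalities.\<close>
  finally have "card ?A * 1 + card ?B * 7 = 2 ^ (n + 1) - 3"
    by simp
  moreover define q :: nat where "q = 2 ^ (n - 1)"
  then have "2 ^ n = 2 * q" "1 \<le> q"
    using n_pos by (simp_all flip: power_Suc)
  \<comment> \<open>Stated additively, the solutions pass to the reals without truncated
    subtraction.\<close>
  ultimately have "3 * card ?B + 1 = q" "3 * card ?A + 2 = 5 * q"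
    using total by simp_all
  then have "3 * card ?B + 1 = 2 ^ (n - 1)" "3 * card ?A + 2 = 5 * 2 ^ (n - 1)"
    by (simp_all only: q_def)
  then have "real (3 * card ?B + 1) = real (2 ^ (n - 1))"
    "real (3 * card ?A + 2) = real (5 * 2 ^ (n - 1))"
    by (simp_all only:)
  then show "real (card ?B) = (2 ^ (n - 1) - 1) / 3" "real (card ?A) = (5 * 2 ^ (n - 1) - 2) / 3"
    by simp_all
qed

end

section \<open>Pointwise criteria, fibre sizes and frequencies combined\<close>

theorem theorem11p4:
  fixes n :: nat
  assumes "odd n" and "CARD('a :: finite_field) = 2 ^ n"
  shows
    "(\<forall>u w :: 'a. u \<noteq> 0 \<longrightarrow> w \<noteq> 0 \<longrightarrow>
       (let z = u * w ^ 4; \<zeta> = 1 + 1 / w; \<tau> = the_root 4 (u / z ^ 5) in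
         ((w \<in> V n u \<longleftrightarrow> nu z = nu \<zeta>) \<and>
          (nu z = nu \<zeta> \<longleftrightarrow> (z + \<zeta>) * (z ^ 2 + \<zeta> * z + \<zeta> ^ 2 + 1) = 0)) \<and>
         ((z = \<zeta> \<longleftrightarrow> u * w ^ 5 = w + 1) \<and>
          (z = \<zeta> \<longrightarrow> w = 1 / (z + 1) \<and> u = z * (z + 1) ^ 4 \<and> z * (z + 1) ^ 4 = z ^ 5 + z)) \<and>
         (z ^ 2 + \<zeta> * z + \<zeta> ^ 2 + 1 = 0 \<longleftrightarrow>
            \<tau> ^ 2 + \<tau> = 1 + 1 / z \<and> u = z ^ 5 * \<tau> ^ 4 \<and> w = 1 / (z * \<tau>)))) \<and>
     (\<forall>w :: 'a. w \<notin> {0, 1} \<longrightarrow>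
        card {u :: 'a. u \<noteq> 0 \<and> w \<in> V n u} =
          (if abs_trace n (1 / (w + 1)) = 0 then 3 else 1)) \<and>
     {u :: 'a. u \<noteq> 0 \<and> 1 \<in> V n u} = {1} \<and>
     real (card {u :: 'a. u \<noteq> 0 \<and> v n u = 3}) = (2 ^ (n - 1) - 1) / 3 \<and>
     real (card {u :: 'a. u \<noteq> 0 \<and> v n u = 1}) = (5 * 2 ^ (n - 1) - 2) / 3"
proof (intro conjI allI impI)
  fix u w :: 'a
  assume uw: "u \<noteq> 0" "w \<noteq> 0"
  show "let z = u * w ^ 4; \<zeta> = 1 + 1 / w; \<tau> = the_root 4 (u / z ^ 5) in
         ((w \<in> V n u \<longleftrightarrow> nu z = nu \<zeta>) \<and>
          (nu z = nu \<zeta> \<longleftrightarrow> (z + \<zeta>) * (z ^ 2 + \<zeta> * z + \<zeta> ^ 2 + 1) = 0)) \<and>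
         ((z = \<zeta> \<longleftrightarrow> u * w ^ 5 = w + 1) \<and>
          (z = \<zeta> \<longrightarrow> w = 1 / (z + 1) \<and> u = z * (z + 1) ^ 4 \<and> z * (z + 1) ^ 4 = z ^ 5 + z)) \<and>
         (z ^ 2 + \<zeta> * z + \<zeta> ^ 2 + 1 = 0 \<longleftrightarrow>
            \<tau> ^ 2 + \<tau> = 1 + 1 / z \<and> u = z ^ 5 * \<tau> ^ 4 \<and> w = 1 / (z * \<tau>))"
    unfolding Let_def
    using mem_V_iff_nu[OF assms uw] nu_eq_iff[OF assms, of "u * w ^ 4" "1 + 1 / w"]
      type_I_iff[OF assms uw(2), of u] type_I_param[OF assms uw(2), of u]
      type_I_poly[OF assms, of "u * w ^ 4"] type_II_iff[OF assms uw]
    by blast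
next
  fix w :: 'a
  assume "w \<notin> {0, 1}"
  then show "card {u. u \<noteq> 0 \<and> w \<in> V n u} = (if abs_trace n (1 / (w + 1)) = 0 then 3 else 1)"
    by (simp add: card_fibre[OF assms])
qed (rule fibre_1[OF assms] card_v_eq[OF assms])+

end
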